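(* Let $n\ge 1$, let $\mu$ be a partition of length at most $n$ and let $r\ge 1$ be an integer. Then $$\overline{p}_r\,\mathrm{o}^{\mathrm{even}}_{\mu}=\sum_{\eta/\mu\in \mathrm{BS}(r)}\frac{(-1)^{\mathrm{ht}(\eta/\mu)}(1+\delta_{\eta_n,0})}{1+\delta_{\mu_n,0}}\,\mathrm{o}^{\mathrm{even}}_{\eta}+\sum_{\mu/\xi\in \mathrm{BS}(r)}\frac{(-1)^{\mathrm{ht}(\mu/\xi)}(1+\delta_{\xi_n,0})}{1+\delta_{\mu_n,0}}\,\mathrm{o}^{\mathrm{even}}_{\xi}+\sum_{q=m_e(\mu)+1}^{n}\frac{(-1)^{p(q)-q}\bigl(1+\delta_{(\mu_e^{(q)})_n,0}\bigr)}{1+\delta_{\mu_n,0}}\,\mathrm{o}^{\mathrm{even}}_{\mu_e^{(q)}},$$ where $\delta_{a,b}$ (two subscripts) is the Kronecker delta, the first sum is over partitions $\eta\supseteq\mu$ such that $\eta/\mu$ is a border strip with $r$ boxes, and the second is over partitions $\xi\subseteq\mu$ such that $\mu/\xi$ is a border strip with $r$ boxes.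
   Context: Let $X=(x_1,\dots,x_n)$ be commuting indeterminates and $\bar x_i=x_i^{-1}$. Put $\overline{p}_r=\sum_{i=1}^n(x_i^r+\bar x_i^{\,r})$. Partitions are identified with their Young diagrams. A border strip is a (nonempty) skew diagram that is connected (any two boxes are joined by a sequence of boxes, consecutive ones sharing a side) and contains no $2\times2$ block of boxes. Its height $\mathrm{ht}$ is one less than its number of nonempty rows. $\mathrm{BS}(r)$ denotes the border strips with exactly $r$ boxes. For a partition $\lambda=(\lambda_1,\dots,\lambda_n)$ of length at most $n$ (padded with zeros), the even orthogonal character is $$\mathrm{o}^{\mathrm{even}}_\lambda=\mathrm{o}^{\mathrm{even}}_\lambda(X)=\frac{2\det_{1\le i,j\le n}\bigl(x_i^{\lambda_j+n-j}+\bar x_i^{\lambda_j+n-j}\bigr)}{(1+\delta_{\lambda_n,0})\det_{1\le i,j\le n}\bigl(x_i^{n-j}+\bar x_i^{n-j}\bigr)}.$$ Partitions of length greater than $n$ contribute nothing to the sums ($\mathrm{o}^{\mathrm{even}}_\lambda$ is taken to be $0$ for them). Let $\delta=(\delta_1,\dots,\delta_n)=(n-1,n-2,\dots,0)$. Define $m_e(\mu)=0$ if $\mu_i+\delta_i<r$ for all $i\in\{1,\dots,n\}$, and $m_e(\mu)=\max\{i\mid \mu_i+\delta_i\ge r\}$ otherwise. For $q$ with $\mu_q+\delta_q-r<0$ (i.e. $q>m_e(\mu)$), let $\Delta_q$ be the rearrangement in descending order of $$(\mu_1+\delta_1,\dots,\mu_{q-1}+\delta_{q-1},\,r-(\mu_q+\delta_q),\,\mu_{q+1}+\delta_{q+1},\dots,\mu_n+\delta_n),$$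 and set $\mu_e^{(q)}=\Delta_q-\delta$. If $r-(\mu_q+\delta_q)=\mu_j+\delta_j$ for some $j\ne q$, then $\mu_e^{(q)}$ is not a partition and one sets $\mathrm{o}^{\mathrm{even}}_{\mu_e^{(q)}}=0$ (the corresponding term of the sum is $0$). Otherwise $\mu_e^{(q)}$ is a partition and $p(q)$ denotes the index (position) of the entry $r-(\mu_q+\delta_q)$ in $\Delta_q$. *)

theory Defs
  imports
    "HOL-Library.Poly_Mapping"
    "HOL-Computational_Algebra.Fraction_Field"
    "Jordan_Normal_Form.Determinant"
begin

section \<open>The indeterminates\<close>

text \<open>
  Polynomials over \<open>'k\<close> in the commuting indeterminates \<open>x\<^sub>0, x\<^sub>1, x\<^sub>2, \<dots>\<close> are finitely supported
  functions from exponent vectors to coefficients; \<open>'k ratfun\<close> is the field of rational functions.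
  For a given \<open>n\<close> only \<open>x\<^sub>1, \<dots>, x\<^sub>n\<close> are used.
\<close>

type_synonym 'k ratfun = "((nat \<Rightarrow>\<^sub>0 nat) \<Rightarrow>\<^sub>0 'k) fract"

definition indet :: "nat \<Rightarrow> 'k::field ratfun"
  where "indet i = Fract (Poly_Mapping.single (Poly_Mapping.single i 1) 1) 1"

definition p_bar :: "nat \<Rightarrow> nat \<Rightarrow> 'k::field ratfun"
  where "p_bar n r = (\<Sum>i=1..n. indet i ^ r + inverse (indet i) ^ r)"


section \<open>Partitions, Young diagrams and border strips\<close>

text \<open>
  Parts are numbered from 1. The unused index 0 always carries the value 0, so that distinct
  functions satisfying the predicate are distinct partitions.
\<close>

definition is_partition :: "(nat \<Rightarrow> nat) \<Rightarrow> bool"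
  where "is_partition lam \<longleftrightarrow>
    lam 0 = 0 \<and> (\<forall>i\<ge>1. lam (Suc i) \<le> lam i) \<and> finite {i. lam i \<noteq> 0}"

definition plength :: "(nat \<Rightarrow> nat) \<Rightarrow> nat"
  where "plength lam = card {i. lam i \<noteq> 0}"

definition young :: "(nat \<Rightarrow> nat) \<Rightarrow> (nat \<times> nat) set"
  where "young lam = {(i, j). 1 \<le> i \<and> 1 \<le> j \<and> j \<le> lam i}"

definition skew_diagram :: "(nat \<times> nat) set \<Rightarrow> bool"
  where "skew_diagram D \<longleftrightarrow>
    (\<exists>lam mu. is_partition lam \<and> is_partition mu \<and> young mu \<subseteq> young lam \<and>
       D = young lam - young mu)"

definition share_side :: "nat \<times> nat \<Rightarrow> nat \<times> nat \<Rightarrow> bool"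
  where "share_side a b \<longleftrightarrow>
    fst a = fst b \<and> (snd a = Suc (snd b) \<or> snd b = Suc (snd a)) \<or>
    snd a = snd b \<and> (fst a = Suc (fst b) \<or> fst b = Suc (fst a))"

definition connected_boxes :: "(nat \<times> nat) set \<Rightarrow> bool"
  where "connected_boxes D \<longleftrightarrow>
    (\<forall>a\<in>D. \<forall>b\<in>D. (a, b) \<in> {(c, d). c \<in> D \<and> d \<in> D \<and> share_side c d}\<^sup>*)"

definition border_strip :: "(nat \<times> nat) set \<Rightarrow> bool"
  where "border_strip D \<longleftrightarrow>
    skew_diagram D \<and> D \<noteq> {} \<and> connected_boxes D \<and>
    \<not> (\<exists>i j. {(i, j), (i, Suc j), (Suc i, j), (Suc i, Suc j)} \<subseteq> D)"

definition BS :: "nat \<Rightarrow> (nat \<times> nat) set set"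
  where "BS r = {D. border_strip D \<and> card D = r}"

definition ht :: "(nat \<times> nat) set \<Rightarrow> nat"
  where "ht D = card (fst ` D) - 1"


section \<open>Even orthogonal characters\<close>

text \<open>Rows and columns of library matrices are numbered from 0, hence the shift by \<open>Suc\<close>.\<close>

definition alternant :: "nat \<Rightarrow> (nat \<Rightarrow> nat) \<Rightarrow> 'k::field ratfun"
  where "alternant n e =
    det (mat n n (\<lambda>(i, j). indet (Suc i) ^ e (Suc j) + inverse (indet (Suc i)) ^ e (Suc j)))"

definition o_even :: "nat \<Rightarrow> (nat \<Rightarrow> nat) \<Rightarrow> 'k::field ratfun"
  where "o_even n lam =
    (if plength lam \<le> n
     then 2 * alternant n (\<lambda>j. lam j + (n - j)) /
          ((1 + of_bool (lam n = 0)) * alternant n (\<lambda>j. n - j))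
     else 0)"


section \<open>The third sum\<close>

definition delta :: "nat \<Rightarrow> nat \<Rightarrow> nat"
  where "delta n i = n - i"

definition m_e :: "nat \<Rightarrow> nat \<Rightarrow> (nat \<Rightarrow> nat) \<Rightarrow> nat"
  where "m_e n r mu =
    (if \<forall>i\<in>{1..n}. mu i + delta n i < r then 0
     else Max {i\<in>{1..n}. mu i + delta n i \<ge> r})"

text \<open>
  The following are used only for \<open>m_e n r mu < q \<le> n\<close>. Then \<open>mu q + delta n q < r\<close>, so the
  subtraction from \<open>r\<close> is not truncated.
\<close>

definition reflected :: "nat \<Rightarrow> nat \<Rightarrow> (nat \<Rightarrow> nat) \<Rightarrow> nat \<Rightarrow> nat"
  where "reflected n r mu q = r - (mu q + delta n q)"

definition Delta :: "nat \<Rightarrow> nat \<Rightarrow> (nat \<Rightarrow> nat) \<Rightarrow> nat \<Rightarrow> nat \<Rightarrow> nat"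
  where "Delta n r mu q i =
    rev (sort (map (\<lambda>j. if j = q then reflected n r mu q else mu j + delta n j) [1..<Suc n]))
      ! (i - 1)"

definition collision :: "nat \<Rightarrow> nat \<Rightarrow> (nat \<Rightarrow> nat) \<Rightarrow> nat \<Rightarrow> bool"
  where "collision n r mu q \<longleftrightarrow>
    (\<exists>j\<in>{1..n}. j \<noteq> q \<and> reflected n r mu q = mu j + delta n j)"

text \<open>
  Without a collision \<open>Delta n r mu q\<close> is strictly decreasing on \<open>{1..n}\<close>, so the subtraction of
  \<open>delta\<close> is not truncated and \<open>mu_e n r mu q\<close> is a partition. With a collision \<open>mu_e\<close> and \<open>pos\<close>
  are irrelevant, since \<open>o_even_mu_e\<close> is then 0.
\<close>

definition mu_e :: "nat \<Rightarrow> nat \<Rightarrow> (nat \<Rightarrow> nat) \<Rightarrow> nat \<Rightarrow> nat \<Rightarrow> nat"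
  where "mu_e n r mu q i = (if i \<in> {1..n} then Delta n r mu q i - delta n i else 0)"

definition pos :: "nat \<Rightarrow> nat \<Rightarrow> (nat \<Rightarrow> nat) \<Rightarrow> nat \<Rightarrow> nat"
  where "pos n r mu q = (THE p. p \<in> {1..n} \<and> Delta n r mu q p = reflected n r mu q)"

definition o_even_mu_e :: "nat \<Rightarrow> nat \<Rightarrow> (nat \<Rightarrow> nat) \<Rightarrow> nat \<Rightarrow> 'k::field ratfun"
  where "o_even_mu_e n r mu q =
    (if collision n r mu q then 0 else o_even n (mu_e n r mu q))"

end

theory Submission
  imports Defs
begin

text \<open>
  Put \<open>l\<^sub>j = \<mu>\<^sub>j + n - j\<close>, a strictly decreasing sequence, and let \<open>A(l)\<close> be the alternant with
  columns \<open>(x\<^sub>i ^ l\<^sub>j + x\<^sub>i ^ (- l\<^sub>j))\<^sub>i\<close>. Up to the factor \<open>1 + \<delta>\<close>, the character is \<open>2 A(l)\<close>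
  divided by a fixed denominator, and the factors \<open>1 + \<delta>\<close> in the coefficients of the rule
  cancel exactly this dependence. So the claim is a formula for \<open>p\<^sub>r A(l)\<close>.

  Multiplying a determinant by \<open>d\<^sub>1 + \<dots> + d\<^sub>n\<close> gives the sum over \<open>q\<close> of the determinants in
  which only column \<open>q\<close> is scaled rowwise by the \<open>d\<^sub>i\<close>. With \<open>d\<^sub>i = x\<^sub>i ^ r + x\<^sub>i ^ (- r)\<close> the scaled
  column splits into those with exponents \<open>l\<^sub>q + r\<close> and \<open>\<bar>l\<^sub>q - r\<bar>\<close>, hence \<open>p\<^sub>r A(l)\<close> is a sum of
  \<open>2 n\<close> alternants (\<open>p_bar_times_alternant\<close>). An alternant with two equal exponents vanishes; in
  every other one the new exponent is moved from position \<open>q\<close> to the position \<open>p\<close> where the sequence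
  becomes decreasing, at the price of the sign \<open>(-1) ^ (p + q)\<close> (\<open>alternant_agree_off\<close>), and the
  result belongs to a partition.

  It remains to recognise the partitions. Raising one \<open>l\<^sub>q\<close> by \<open>r\<close> and re-sorting is the same as adding
  a border strip of \<open>r\<close> boxes: the strip occupies the rows \<open>p, \<dots>, q\<close>, so its height is \<open>q - p\<close>
  (\<open>border_strip_iff_agree_off\<close>, \<open>ht_sign\<close>). Thus the exponents \<open>l\<^sub>q + r\<close> yield the first sum of the
  rule, the exponents \<open>l\<^sub>q - r \<ge> 0\<close> yield the second one by the same statement read backwards, and the
  exponents \<open>r - l\<^sub>q > 0\<close>, which occur for \<open>q > m\<^sub>e(\<mu>)\<close>, yield the third (\<open>reflected_term\<close>).
\<close>

section \<open>Products with alternants\<close>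

definition sym_power :: "nat \<Rightarrow> nat \<Rightarrow> 'k::field ratfun"
  where "sym_power i v = indet i ^ v + inverse (indet i) ^ v"

definition alt_mat :: "nat \<Rightarrow> (nat \<Rightarrow> nat) \<Rightarrow> 'k::field ratfun mat"
  where "alt_mat n e = mat n n (\<lambda>(i, j). sym_power (Suc i) (e (Suc j)))"

lemma alt_mat_carrier [simp]: "alt_mat n e \<in> carrier_mat n n"
  by (simp add: alt_mat_def)

lemma alternant_eq_det: "alternant n e = det (alt_mat n e)"
  unfolding alternant_def alt_mat_def sym_power_def ..

lemma indet_nonzero: "(indet i :: 'k::field ratfun) \<noteq> 0"
proof -
  have "(Poly_Mapping.single (Poly_Mapping.single i 1) 1 :: (nat \<Rightarrow>\<^sub>0 nat) \<Rightarrow>\<^sub>0 'k) \<noteq> 0"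
    by (metis lookup_single_eq lookup_zero zero_neq_one)
  then show ?thesis by (simp add: indet_def Zero_fract_def eq_fract)
qed

text \<open>
  With \<open>x\<^sub>i = exp t\<close>, \<open>sym_power i v\<close> is \<open>2 cosh (v t)\<close>, and this is the product formula
  \<open>2 cosh a cosh b = cosh (a + b) + cosh (a - b)\<close>. As \<open>cosh\<close> is even, the difference of the exponents may
  be replaced by its absolute value.
\<close>

lemma sym_power_mult:
  "(sym_power i r :: 'k::field ratfun) * sym_power i v =
     sym_power i (v + r) + sym_power i (if r \<le> v then v - r else r - v)"
proof -
  let ?x = "indet i :: 'k ratfun" and ?y = "inverse (indet i) :: 'k ratfun"
  have one: "?x ^ a * ?y ^ a = 1" for a
    by (simp add: indet_nonzero flip: power_mult_distrib)
  have one': "?x ^ a * (?y ^ a * z) = z" for a z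
    by (simp only: mult.assoc[symmetric] one mult_1_left)
  have expand: "sym_power i a * (sym_power i (a + d) :: 'k ratfun) =
      sym_power i (a + d + a) + sym_power i d" for a d
  proof -
    have "sym_power i a * (sym_power i (a + d) :: 'k ratfun) =
        sym_power i (a + d + a) + (?x ^ a * (?y ^ a * ?y ^ d) + ?x ^ a * (?y ^ a * ?x ^ d))"
      by (simp add: sym_power_def power_add algebra_simps)
    then show ?thesis by (simp add: one' sym_power_def add.commute)
  qed
  show ?thesis
  proof (cases "r \<le> v")
    case True
    then show ?thesis using expand[of r "v - r"] by simp
  next
    case False
    then show ?thesis using expand[of v "r - v"] by (simp add: add.commute mult.commute)
  qed
qed

text \<open>
  Laplace expansion along column \<open>q\<close>: its cofactors do not involve the exponent \<open>e q\<close>, so as a function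
  of that exponent the alternant is a fixed linear combination of the \<open>sym_power\<close>s.
\<close>

lemma alternant_upd:
  assumes "q \<in> {1..n}"
  shows "(alternant n (e(q := v)) :: 'k::field ratfun) =
    (\<Sum>i<n. sym_power (Suc i) v * cofactor (alt_mat n e) i (q - 1))"
proof -
  have "cofactor (alt_mat n (e(q := v))) i (q - 1) = (cofactor (alt_mat n e) i (q - 1) :: 'k ratfun)" for i
  proof -
    have "mat_delete (alt_mat n (e(q := v))) i (q - 1) = (mat_delete (alt_mat n e) i (q - 1) :: 'k ratfun mat)"
      unfolding mat_delete_def alt_mat_def using assms by (intro eq_matI) auto
    then show ?thesis by (simp add: cofactor_def)
  qed
  then show ?thesis
    unfolding alternant_eq_det
    by (subst laplace_expansion_column[OF alt_mat_carrier, of "q - 1"])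
       (use assms in \<open>auto simp: alt_mat_def\<close>)
qed

lemma alternant_expand_row:
  assumes "i < n"
  shows "(alternant n e :: 'k::field ratfun) =
    (\<Sum>q = 1..n. sym_power (Suc i) (e q) * cofactor (alt_mat n e) i (q - 1))"
proof -
  have "(alternant n e :: 'k ratfun) = (\<Sum>j<n. alt_mat n e $$ (i, j) * cofactor (alt_mat n e) i j)"
    unfolding alternant_eq_det by (rule laplace_expansion_row[OF alt_mat_carrier assms])
  also have "\<dots> = (\<Sum>j<n. sym_power (Suc i) (e (Suc j)) * cofactor (alt_mat n e) i j)"
    using assms by (intro sum.cong) (auto simp: alt_mat_def)
  also have "\<dots> = (\<Sum>q = 1..n. sym_power (Suc i) (e q) * cofactor (alt_mat n e) i (q - 1))"
    by (simp add: sum.atLeast1_atMost_eq)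
  finally show ?thesis .
qed

text \<open>
  Each row expansion writes the same determinant as a sum over columns. Weighting row \<open>i\<close> by its
  factor of \<open>p_bar\<close> and exchanging the summations regroups everything into column expansions, in which
  one column has been multiplied rowwise.
\<close>

lemma p_bar_times_alternant:
  "(p_bar n r :: 'k::field ratfun) * alternant n e =
     (\<Sum>q = 1..n. alternant n (e(q := e q + r)))
   + (\<Sum>q = 1..n. alternant n (e(q := if r \<le> e q then e q - r else r - e q)))"
proof -
  let ?C = "\<lambda>i q. cofactor (alt_mat n e) i (q - 1) :: 'k ratfun"
  have "(p_bar n r :: 'k ratfun) = (\<Sum>i<n. sym_power (Suc i) r)"
    unfolding p_bar_def sym_power_def by (simp add: sum.atLeast1_atMost_eq)
  then have "(p_bar n r :: 'k ratfun) * alternant n e =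
      (\<Sum>i<n. sym_power (Suc i) r * alternant n e)"
    by (simp add: sum_distrib_right)
  also have "\<dots> = (\<Sum>i<n. \<Sum>q = 1..n. (sym_power (Suc i) r * sym_power (Suc i) (e q)) * ?C i q)"
    by (intro sum.cong refl, subst alternant_expand_row)
       (auto simp: sum_distrib_left mult.assoc)
  also have "\<dots> = (\<Sum>q = 1..n. \<Sum>i<n. sym_power (Suc i) (e q + r) * ?C i q
      + sym_power (Suc i) (if r \<le> e q then e q - r else r - e q) * ?C i q)"
    by (subst sum.swap) (simp only: sym_power_mult distrib_right)
  also have "\<dots> = (\<Sum>q = 1..n. alternant n (e(q := e q + r))
      + alternant n (e(q := if r \<le> e q then e q - r else r - e q)))"
    by (intro sum.cong refl) (simp only: sum.distrib alternant_upd)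
  finally show ?thesis by (simp only: sum.distrib)
qed

lemma alternant_collision:
  assumes "a \<in> {1..n}" "b \<in> {1..n}" "a \<noteq> b" "e a = e b"
  shows "(alternant n e :: 'k::field ratfun) = 0"
  unfolding alternant_eq_det
  by (rule det_identical_columns[of _ n "a - 1" "b - 1"])
     (use assms in \<open>auto simp: alt_mat_def intro!: eq_vecI\<close>)

text \<open>
  The increasing enumeration of all numbers except \<open>q\<close>.
\<close>

definition skip :: "nat \<Rightarrow> nat \<Rightarrow> nat"
  where "skip q k = (if k < q then k else Suc k)"

text \<open>
  The sequence \<open>g\<close> arises from \<open>f\<close> by changing the term at \<open>q\<close> and moving it to position \<open>p\<close>. In terms of
  deletions this relation is symmetric, and it matches the minors in a column expansion.
\<close>

definition agree_off :: "nat \<Rightarrow> (nat \<Rightarrow> nat) \<Rightarrow> nat \<Rightarrow> (nat \<Rightarrow> nat) \<Rightarrow> nat \<Rightarrow> bool"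
  where "agree_off n f q g p \<longleftrightarrow>
    q \<in> {1..n} \<and> p \<in> {1..n} \<and> (\<forall>k\<in>{1..<n}. f (skip q k) = g (skip p k))"

text \<open>
  Moving the exponent \<open>g p\<close> from column \<open>q\<close> to column \<open>p\<close>, past \<open>\<bar>p - q\<bar>\<close> other columns. No
  permutation is needed: expanded along these columns, both determinants have the same minors, and
  only the checkerboard signs of the cofactors differ.
\<close>

lemma alternant_agree_off:
  assumes "agree_off n f q g p"
  shows "(alternant n (f(q := g p)) :: 'k::field ratfun) = (-1) ^ (p + q) * alternant n g"
proof -
  have pq: "p \<in> {1..n}" "q \<in> {1..n}"
    and skip: "\<And>k. k \<in> {1..<n} \<Longrightarrow> g (skip p k) = f (skip q k)"
    using assms by (simp_all add: agree_off_def)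
  have cof: "cofactor (alt_mat n f) i (q - 1) = (-1) ^ (p + q) * (cofactor (alt_mat n g) i (p - 1) :: 'k ratfun)" for i
  proof -
    have "mat_delete (alt_mat n f) i (q - 1) = (mat_delete (alt_mat n g) i (p - 1) :: 'k ratfun mat)"
    proof (rule eq_matI)
      fix a b assume "a < dim_row (mat_delete (alt_mat n g) i (p - 1) :: 'k ratfun mat)"
        "b < dim_col (mat_delete (alt_mat n g) i (p - 1) :: 'k ratfun mat)"
      then have ab: "a < n - 1" "b < n - 1" by (auto simp: mat_delete_def alt_mat_def)
      have entry: "mat_delete (alt_mat n e) i (c - 1) $$ (a, b) =
          (sym_power (Suc (if a < i then a else Suc a)) (e (skip c (Suc b))) :: 'k ratfun)"
        if "c \<in> {1..n}" for c e
        using ab that by (auto simp: mat_delete_def alt_mat_def skip_def)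
      have "g (skip p (Suc b)) = f (skip q (Suc b))"
        using ab by (intro skip) auto
      then show "mat_delete (alt_mat n f) i (q - 1) $$ (a, b) =
          (mat_delete (alt_mat n g) i (p - 1) $$ (a, b) :: 'k ratfun)"
        using pq by (simp only: entry)
    qed (auto simp: mat_delete_def alt_mat_def)
    moreover have "(-1) ^ (i + (q - 1)) = (-1) ^ (p + q) * ((-1) ^ (i + (p - 1)) :: 'k ratfun)"
      using pq by (auto simp: minus_one_power_iff)
    ultimately show ?thesis by (simp add: cofactor_def)
  qed
  have "(alternant n (f(q := g p)) :: 'k ratfun) = (-1) ^ (p + q) * alternant n (g(p := g p))"
    unfolding alternant_upd[OF pq(1)] alternant_upd[OF pq(2)] cof sum_distrib_left
    by (simp add: mult_ac)
  then show ?thesis by simp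
qed

section \<open>Strictly decreasing sequences\<close>

text \<open>
  A finite set of numbers has only one decreasing enumeration: by induction, the \<open>i\<close>-th value of one
  sequence occurs in the other at a position not before \<open>i\<close>, which gives both inequalities.
\<close>

lemma strict_antimono_on_unique:
  fixes f g :: "nat \<Rightarrow> nat"
  assumes f: "strict_antimono_on {1..n} f" and g: "strict_antimono_on {1..n} g"
    and image: "f ` {1..n} = g ` {1..n}"
    and "i \<in> {1..n}"
  shows "f i = g i"
  using \<open>i \<in> {1..n}\<close>
proof (induction i rule: less_induct)
  case (less i)
  have bound: "a i \<le> b i"
    if a: "strict_antimono_on {1..n} a" and b: "strict_antimono_on {1..n} b"
      and ab: "a ` {1..n} = b ` {1..n}" and agree: "\<And>k. k < i \<Longrightarrow> k \<in> {1..n} \<Longrightarrow> a k = b k"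
    for a b :: "nat \<Rightarrow> nat"
  proof -
    obtain k where k: "k \<in> {1..n}" "a i = b k"
      using ab less.prems by (metis image_iff)
    have "i \<le> k"
    proof (rule ccontr)
      assume "\<not> i \<le> k"
      then have "a i < a k" using monotone_onD[OF a k(1) less.prems] by simp
      then show False using agree[of k] k \<open>\<not> i \<le> k\<close> by simp
    qed
    then have "b k \<le> b i"
      using monotone_onD[OF b less.prems k(1)] by (cases "i = k") auto
    then show ?thesis using k by simp
  qed
  show ?case
    using bound[OF f g image] bound[OF g f image[symmetric]] less.IH by (metis order_antisym)
qed

definition descending :: "nat \<Rightarrow> (nat \<Rightarrow> nat) \<Rightarrow> nat \<Rightarrow> nat"
  where "descending n h i = rev (sort (map h [1..<Suc n])) ! (i - 1)"

lemma
  assumes "inj_on h {1..n}"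
  shows strict_antimono_on_descending: "strict_antimono_on {1..n} (descending n h)"
    and image_descending: "descending n h ` {1..n} = h ` {1..n}"
proof -
  define xs where "xs = sort (map h [1..<Suc n])"
  have [simp]: "length xs = n" and set: "set xs = h ` {1..n}"
    by (auto simp: xs_def simp del: upt_Suc)
  have "distinct xs"
    using assms by (simp add: xs_def distinct_map atLeastLessThanSuc_atLeastAtMost del: upt_Suc)
  then have sorted: "sorted_wrt (<) xs"
    by (simp add: strict_sorted_iff xs_def del: upt_Suc)
  have nth: "descending n h i = xs ! (n - i)" if "i \<in> {1..n}" for i
  proof -
    have "Suc (i - 1) = i" "i - 1 < length xs" using that by auto
    then show ?thesis
      unfolding descending_def xs_def[symmetric] by (subst rev_nth) simp_all
  qed
  show "strict_antimono_on {1..n} (descending n h)"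
  proof (rule monotone_onI)
    fix i j assume "i \<in> {1..n}" "j \<in> {1..n}" "i < j"
    then show "descending n h j < descending n h i"
      using sorted_wrt_nth_less[OF sorted, of "n - j" "n - i"] by (simp add: nth)
  qed
  have "descending n h ` {1..n} = (\<lambda>i. xs ! (n - i)) ` {1..n}"
    using nth by (intro image_cong) auto
  also have "\<dots> = (!) xs ` ((\<lambda>i. n - i) ` {1..n})"
    by (simp add: image_image)
  also have "(\<lambda>i. n - i) ` {1..n} = {..<n}"
  proof
    show "{..<n} \<subseteq> (\<lambda>i. n - i) ` {1..n}"
    proof
      fix k assume "k \<in> {..<n}"
      then have "k = n - (n - k)" "n - k \<in> {1..n}" by auto
      then show "k \<in> (\<lambda>i. n - i) ` {1..n}" by blast
    qed
  qed auto
  also have "(!) xs ` {..<n} = set xs"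
    by (auto simp: set_conv_nth)
  finally show "descending n h ` {1..n} = h ` {1..n}" using set by simp
qed

lemma skip_image:
  assumes "q \<in> {1..n}"
  shows "skip q ` {1..<n} = {1..n} - {q}"
proof
  show "{1..n} - {q} \<subseteq> skip q ` {1..<n}"
  proof
    fix i assume "i \<in> {1..n} - {q}"
    then have "i = skip q (if i < q then i else i - 1)" "(if i < q then i else i - 1) \<in> {1..<n}"
      using assms by (auto simp: skip_def)
    then show "i \<in> skip q ` {1..<n}" by blast
  qed
qed (use assms in \<open>auto simp: skip_def split: if_splits\<close>)

lemma strict_antimono_on_skip:
  assumes "strict_antimono_on {1..n} f" "q \<in> {1..n}"
  shows "strict_antimono_on {1..n - 1} (\<lambda>k. f (skip q k))"
  using assms by (fastforce simp: monotone_on_def skip_def)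

lemma agree_off_mem:
  assumes "agree_off n f q g p"
  shows "q \<in> {1..n}" "p \<in> {1..n}"
  using assms by (simp_all add: agree_off_def)

lemma agree_off_sym: "agree_off n f q g p \<longleftrightarrow> agree_off n g p f q"
  by (auto simp: agree_off_def)

lemma agree_off_image:
  assumes "agree_off n f q g p"
  shows "f ` ({1..n} - {q}) = g ` ({1..n} - {p})"
proof -
  have "f ` skip q ` {1..<n} = g ` skip p ` {1..<n}"
    using assms unfolding agree_off_def image_image by (intro image_cong) blast+
  then show ?thesis using assms by (simp only: agree_off_def skip_image)
qed

lemma agree_off_range:
  assumes "agree_off n f q g p"
  shows "g ` {1..n} = insert (g p) (f ` ({1..n} - {q}))"
proof -
  have "p \<in> {1..n}" using assms by (simp add: agree_off_def)
  then have "g ` {1..n} = insert (g p) (g ` ({1..n} - {p}))" by blast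
  then show ?thesis by (simp only: agree_off_image[OF assms])
qed

lemma agree_off_cong:
  assumes "agree_off n f q g p" "\<And>i. i \<in> {1..n} \<Longrightarrow> g i = h i"
  shows "agree_off n f q h p"
proof -
  have "g (skip p k) = h (skip p k)" if "k \<in> {1..<n}" for k
    using that by (intro assms(2)) (auto simp: skip_def)
  then show ?thesis using assms(1) by (simp add: agree_off_def)
qed

text \<open>
  After the deletions both sequences are decreasing enumerations of one set, hence equal.
\<close>

lemma agree_offI:
  assumes f: "strict_antimono_on {1..n} f" and q: "q \<in> {1..n}"
    and g: "strict_antimono_on {1..n} g" and p: "p \<in> {1..n}"
    and image: "g ` ({1..n} - {p}) = f ` ({1..n} - {q})"
  shows "agree_off n f q g p"
proof -
  have range: "{1..<n} = {1..n - 1}" by auto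
  have "(\<lambda>k. f (skip q k)) ` {1..n - 1} = (\<lambda>k. g (skip p k)) ` {1..n - 1}"
    using image skip_image[OF p] skip_image[OF q] unfolding range
    by (metis image_image)
  then have "f (skip q k) = g (skip p k)" if "k \<in> {1..<n}" for k
    using strict_antimono_on_unique[OF strict_antimono_on_skip[OF f q] strict_antimono_on_skip[OF g p]]
      that unfolding range by blast
  then show ?thesis using p q by (simp add: agree_off_def)
qed

text \<open>
  Replacing one term of a decreasing sequence by a value that causes no collision and sorting again
  moves that value and leaves the order of the other terms alone.
\<close>

lemma agree_off_descending:
  assumes f: "strict_antimono_on {1..n} f" and q: "q \<in> {1..n}"
    and v: "v \<notin> f ` ({1..n} - {q})"
  obtains p where "strict_antimono_on {1..n} (descending n (f(q := v)))"
    "agree_off n f q (descending n (f(q := v))) p" "descending n (f(q := v)) p = v"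
proof -
  let ?g = "descending n (f(q := v))"
  have f_inj: "inj_on f {1..n}"
    using f by (simp add: strict_antimono_iff_antimono)
  have inj: "inj_on (f(q := v)) {1..n}"
  proof (rule inj_onI)
    fix a b assume ab: "a \<in> {1..n}" "b \<in> {1..n}" "(f(q := v)) a = (f(q := v)) b"
    have "a \<noteq> q \<Longrightarrow> f a \<noteq> v" "b \<noteq> q \<Longrightarrow> f b \<noteq> v"
      using v ab(1,2) by blast+
    then show "a = b"
      using ab(3) inj_onD[OF f_inj _ ab(1,2)] by (metis fun_upd_apply)
  qed
  have image: "?g ` {1..n} = insert v (f ` ({1..n} - {q}))"
    unfolding image_descending[OF inj] using q by (simp only: fun_upd_image if_True)
  note g = strict_antimono_on_descending[OF inj]
  obtain p where p: "p \<in> {1..n}" "?g p = v" using image by (metis image_iff insertI1)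
  have "inj_on ?g {1..n}" using g by (simp add: strict_antimono_iff_antimono)
  then have "?g ` ({1..n} - {p}) = ?g ` {1..n} - {v}"
    using p inj_on_image_set_diff[of ?g "{1..n}" "{1..n}" "{p}"] by simp
  also have "\<dots> = f ` ({1..n} - {q})" unfolding image using v by blast
  finally show ?thesis using agree_offI[OF f q g] p g that by blast
qed

lemma agree_off_descending_unique:
  assumes "agree_off n f q g p" "strict_antimono_on {1..n} g" "i \<in> {1..n}"
  shows "g i = descending n (f(q := g p)) i"
proof -
  have p: "p \<in> {1..n}" and q: "q \<in> {1..n}" using assms by (auto simp: agree_off_def)
  have g: "inj_on g {1..n}" using assms(2) by (simp add: strict_antimono_iff_antimono)
  have upd: "f(q := g p) ` {1..n} = g ` {1..n}"
    using agree_off_image[OF assms(1)] p q by (auto simp: image_iff)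
  then have inj: "inj_on (f(q := g p)) {1..n}"
    using g by (metis card_image eq_card_imp_inj_on finite_atLeastAtMost)
  have "g ` {1..n} = descending n (f(q := g p)) ` {1..n}"
    by (simp only: image_descending[OF inj] upd)
  then show ?thesis
    using strict_antimono_on_unique[OF assms(2) strict_antimono_on_descending[OF inj]] assms(3)
    by blast
qed

section \<open>Partitions and their beta numbers\<close>

lemma partition_antimono:
  assumes "is_partition lam" "1 \<le> i" "i \<le> j"
  shows "lam j \<le> lam i"
  using \<open>i \<le> j\<close>
proof (induction j rule: dec_induct)
  case (step j)
  then show ?case using assms unfolding is_partition_def by (meson le_trans)
qed simp

lemma plength_le_iff:
  assumes "is_partition lam"
  shows "plength lam \<le> n \<longleftrightarrow> (\<forall>i>n. lam i = 0)"
proof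
  assume le: "plength lam \<le> n"
  show "\<forall>i>n. lam i = 0"
  proof (intro allI impI, rule ccontr)
    fix i assume i: "n < i" "lam i \<noteq> 0"
    have "{1..i} \<subseteq> {i. lam i \<noteq> 0}"
      using partition_antimono[OF assms, of _ i] i by fastforce
    then have "i \<le> plength lam"
      using card_mono[of "{i. lam i \<noteq> 0}" "{1..i}"] assms
      by (simp add: plength_def is_partition_def)
    then show False using le i by simp
  qed
next
  assume "\<forall>i>n. lam i = 0"
  then have "{i. lam i \<noteq> 0} \<subseteq> {1..n}"
    using assms by (auto simp: is_partition_def Suc_le_eq intro!: Nat.gr0I leI)
  then show "plength lam \<le> n"
    using card_mono[of "{1..n}" "{i. lam i \<noteq> 0}"] by (simp add: plength_def)
qed

text \<open>
  The beta numbers (first-column hook lengths, if \<open>n\<close> is the length) of a partition.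
\<close>

definition beta_number :: "nat \<Rightarrow> (nat \<Rightarrow> nat) \<Rightarrow> nat \<Rightarrow> nat"
  where "beta_number n lam j = lam j + (n - j)"

lemma strict_antimono_on_beta_number:
  assumes "is_partition lam"
  shows "strict_antimono_on {1..n} (beta_number n lam)"
proof (rule monotone_onI)
  fix i j assume "i \<in> {1..n}" "j \<in> {1..n}" "i < j"
  then show "beta_number n lam j < beta_number n lam i"
    using partition_antimono[OF assms, of i j] by (simp add: beta_number_def)
qed

lemma beta_number_inject:
  assumes "is_partition lam" "is_partition mu" "plength lam \<le> n" "plength mu \<le> n"
    and "\<And>i. i \<in> {1..n} \<Longrightarrow> beta_number n lam i = beta_number n mu i"
  shows "lam = mu"
proof
  fix i
  consider "i = 0" | "i \<in> {1..n}" | "i > n" by force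
  then show "lam i = mu i"
  proof cases
    case 2
    then have "lam i + (n - i) = mu i + (n - i)" using assms(5)[of i] by (simp only: beta_number_def)
    then show ?thesis by (rule add_right_imp_eq)
  qed (use assms plength_le_iff in \<open>auto simp: is_partition_def\<close>)
qed

text \<open>
  The partition with given beta numbers.
\<close>

definition shape :: "nat \<Rightarrow> (nat \<Rightarrow> nat) \<Rightarrow> nat \<Rightarrow> nat"
  where "shape n h i = (if i \<in> {1..n} then h i - (n - i) else 0)"

lemma
  assumes h: "strict_antimono_on {1..n} h"
  shows is_partition_shape: "is_partition (shape n h)"
    and plength_shape: "plength (shape n h) \<le> n"
    and beta_number_shape: "i \<in> {1..n} \<Longrightarrow> beta_number n (shape n h) i = h i"
proof -
  \<comment> \<open>The values decrease strictly from \<open>i\<close> to \<open>n\<close>, so the subtraction in \<open>shape\<close> is not truncated.\<close>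
  have descent: "h (Suc i) < h i" if "1 \<le> i" "i < n" for i
    using that by (intro monotone_onD[OF h]) auto
  have bound: "n - i \<le> h i" if "i \<in> {1..n}" for i
  proof -
    have "i \<le> n" using that by simp
    then show ?thesis
      using that
    proof (induction i rule: inc_induct)
      case (step i)
      then show ?case using descent[of i] by auto
    qed simp
  qed
  show "i \<in> {1..n} \<Longrightarrow> beta_number n (shape n h) i = h i"
    using bound[of i] by (simp add: beta_number_def shape_def)
  have "{i. shape n h i \<noteq> 0} \<subseteq> {1..n}" by (auto simp: shape_def)
  then have "finite {i. shape n h i \<noteq> 0}" by (rule finite_subset) simp
  moreover have "shape n h (Suc i) \<le> shape n h i" if "1 \<le> i" for i
    using that descent[of i] bound[of "Suc i"] by (auto simp: shape_def)
  ultimately show part: "is_partition (shape n h)"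
    by (simp add: is_partition_def) (simp add: shape_def)
  show "plength (shape n h) \<le> n"
    by (simp add: plength_le_iff[OF part] shape_def)
qed

text \<open>
  Sorting distinct numbers gives a strictly decreasing sequence, and every such sequence consists of
  the beta numbers of a partition.
\<close>

lemma shape_replace:
  assumes mu: "is_partition mu" and q: "q \<in> {1..n}"
    and v: "v \<notin> beta_number n mu ` ({1..n} - {q})"
  defines "lam \<equiv> shape n (descending n ((beta_number n mu)(q := v)))"
  obtains p where "is_partition lam" "plength lam \<le> n"
    "\<forall>i\<in>{1..n}. beta_number n lam i = descending n ((beta_number n mu)(q := v)) i"
    "agree_off n (beta_number n mu) q (beta_number n lam) p" "beta_number n lam p = v"
proof -
  let ?g = "descending n ((beta_number n mu)(q := v))"
  obtain p where g: "strict_antimono_on {1..n} ?g" and p: "agree_off n (beta_number n mu) q ?g p" "?g p = v"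
    using agree_off_descending[OF strict_antimono_on_beta_number[OF mu] q v] by blast
  note shape = is_partition_shape[OF g] plength_shape[OF g] beta_number_shape[OF g]
  have "p \<in> {1..n}" using p(1) by (simp add: agree_off_def)
  then have "beta_number n lam p = v" unfolding lam_def using shape(3) p(2) by simp
  moreover have "agree_off n (beta_number n mu) q (beta_number n lam) p"
    unfolding lam_def using shape(3) by (intro agree_off_cong[OF p(1)]) simp
  ultimately show ?thesis using shape that unfolding lam_def by blast
qed

section \<open>Border strips in terms of beta numbers\<close>

text \<open>
  The rows \<open>p, \<dots>, q\<close> form a border strip: two consecutive rows of the strip overlap in exactly one
  column, so row \<open>Suc i\<close> ends where row \<open>i\<close> begins.
\<close>

definition strip_rows :: "(nat \<Rightarrow> nat) \<Rightarrow> (nat \<Rightarrow> nat) \<Rightarrow> nat \<Rightarrow> nat \<Rightarrow> bool"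
  where "strip_rows lam mu p q \<longleftrightarrow> 1 \<le> p \<and> p \<le> q \<and>
    (\<forall>i. i < p \<or> q < i \<longrightarrow> lam i = mu i) \<and>
    mu p < lam p \<and> (\<forall>i. p \<le> i \<and> i < q \<longrightarrow> lam (Suc i) = Suc (mu i))"

lemma mem_young: "is_partition lam \<Longrightarrow> (i, j) \<in> young lam \<longleftrightarrow> 1 \<le> j \<and> j \<le> lam i"
  by (auto simp: young_def is_partition_def Suc_le_eq intro!: Nat.gr0I)

lemma young_subset_iff:
  assumes "is_partition lam" "is_partition mu"
  shows "young mu \<subseteq> young lam \<longleftrightarrow> (\<forall>i. mu i \<le> lam i)"
proof
  assume sub: "young mu \<subseteq> young lam"
  show "\<forall>i. mu i \<le> lam i"
  proof
    fix i
    have "mu i = 0 \<or> (i, mu i) \<in> young mu" unfolding mem_young[OF assms(2)] by auto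
    then have "mu i = 0 \<or> (i, mu i) \<in> young lam" using sub by blast
    then show "mu i \<le> lam i" unfolding mem_young[OF assms(1)] by auto
  qed
next
  assume le: "\<forall>i. mu i \<le> lam i"
  then have "(i, j) \<in> young lam" if "(i, j) \<in> young mu" for i j
    using that unfolding mem_young[OF assms(1)] mem_young[OF assms(2)] by (meson order_trans)
  then show "young mu \<subseteq> young lam" by (rule subrelI)
qed

lemma mem_skew:
  assumes "is_partition lam" "is_partition mu"
  shows "(i, j) \<in> young lam - young mu \<longleftrightarrow> mu i < j \<and> j \<le> lam i"
  unfolding Diff_iff mem_young[OF assms(1)] mem_young[OF assms(2)] by auto

text \<open>
  A path of boxes from row \<open>i\<close> or above to a row below \<open>i\<close> has to take a vertical step out of row \<open>i\<close>.
\<close>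

lemma connected_boxes_crossing:
  assumes "(a, b) \<in> {(c, d). c \<in> D \<and> d \<in> D \<and> share_side c d}\<^sup>*"
    and "fst a \<le> i" "i < fst b"
  obtains j where "(i, j) \<in> D" "(Suc i, j) \<in> D"
proof -
  have "i < fst b \<longrightarrow> (\<exists>j. (i, j) \<in> D \<and> (Suc i, j) \<in> D)"
    using assms(1)
  proof (induction rule: rtrancl_induct)
    case base
    then show ?case using assms(2) by simp
  next
    case (step y z)
    show ?case
    proof (cases "i < fst y")
      case False
      then show ?thesis
        using step.hyps(2) by (cases y; cases z) (auto simp: share_side_def less_Suc_eq_le)
    qed (use step.IH in simp)
  qed
  then show ?thesis using assms(3) that by blast
qed

text \<open>
  Between the first and the last row of the strip, connectedness makes consecutive rows overlap in at
  least one column, and the absence of \<open>2 \<times> 2\<close> blocks in at most one.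
\<close>

lemma strip_rows_if_border_strip:
  assumes lam: "is_partition lam" and mu: "is_partition mu"
    and sub: "young mu \<subseteq> young lam" and strip: "border_strip (young lam - young mu)"
  obtains p q where "strip_rows lam mu p q"
proof -
  let ?D = "young lam - young mu"
  define R where "R = {i. mu i < lam i}"
  have le: "mu i \<le> lam i" for i using sub young_subset_iff[OF lam mu] by blast
  have D: "(i, j) \<in> ?D \<longleftrightarrow> mu i < j \<and> j \<le> lam i" for i j by (rule mem_skew[OF lam mu])
  have "R \<subseteq> {i. lam i \<noteq> 0}" by (auto simp: R_def)
  then have fin: "finite R" by (rule finite_subset) (use lam in \<open>simp add: is_partition_def\<close>)
  obtain a where "a \<in> ?D" using strip unfolding border_strip_def by blast
  then have "fst a \<in> R" using D[of "fst a" "snd a"] by (simp add: R_def)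
  then have ne: "R \<noteq> {}" by blast
  define p q where "p = Min R" and "q = Max R"
  have p: "p \<in> R" "\<And>i. i \<in> R \<Longrightarrow> p \<le> i" and q: "q \<in> R" "\<And>i. i \<in> R \<Longrightarrow> i \<le> q"
    using fin ne by (auto simp: p_def q_def)
  have "p \<noteq> 0" using p(1) lam by (auto simp: R_def is_partition_def intro!: Nat.gr0I)
  have "lam (Suc i) = Suc (mu i)" if i: "p \<le> i" "i < q" for i
  proof (rule antisym)
    have "(p, lam p) \<in> ?D" "(q, lam q) \<in> ?D" using p(1) q(1) unfolding D R_def by auto
    then have "((p, lam p), (q, lam q)) \<in> {(c, d). c \<in> ?D \<and> d \<in> ?D \<and> share_side c d}\<^sup>*"
      using strip unfolding border_strip_def connected_boxes_def by blast
    then obtain j where "(i, j) \<in> ?D" "(Suc i, j) \<in> ?D"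
      by (rule connected_boxes_crossing) (use i in simp_all)
    then show "Suc (mu i) \<le> lam (Suc i)" unfolding D by simp
    have "lam (Suc i) \<le> lam i" "mu (Suc i) \<le> mu i"
      using lam mu i \<open>p \<noteq> 0\<close> by (auto simp: is_partition_def)
    then have "{(i, Suc (mu i)), (i, Suc (Suc (mu i))), (Suc i, Suc (mu i)), (Suc i, Suc (Suc (mu i)))} \<subseteq> ?D"
      if "Suc (mu i) < lam (Suc i)"
      unfolding insert_subset D using that by simp
    then show "lam (Suc i) \<le> Suc (mu i)"
      using strip unfolding border_strip_def by (meson not_le)
  qed
  moreover have "lam i = mu i" if "i < p \<or> q < i" for i
  proof -
    have "i \<notin> R" using that p(2) q(2) by fastforce
    then show ?thesis using le[of i] by (simp add: R_def)
  qed
  ultimately have "strip_rows lam mu p q"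
    using p q \<open>p \<noteq> 0\<close> by (auto simp: strip_rows_def R_def)
  then show ?thesis by (rule that)
qed

lemma strip_rows_gap:
  assumes "is_partition lam" "is_partition mu" "strip_rows lam mu p q"
  shows "mu i \<le> lam i" and "mu i < lam i \<longleftrightarrow> i \<in> {p..q}"
proof -
  have "mu i < lam i" if i: "i \<in> {p..q}"
  proof (cases "i = p")
    case False
    then obtain k where "i = Suc k" "p \<le> k" "k < q"
      using i \<open>strip_rows lam mu p q\<close> by (cases i) (auto simp: strip_rows_def)
    then show ?thesis
      using assms by (auto simp: strip_rows_def is_partition_def less_Suc_eq_le)
  qed (use assms in \<open>simp add: strip_rows_def\<close>)
  moreover have "lam i = mu i" if "i \<notin> {p..q}"
    using assms that by (auto simp: strip_rows_def not_le)
  ultimately show "mu i \<le> lam i" "mu i < lam i \<longleftrightarrow> i \<in> {p..q}"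
    by (fastforce intro: less_imp_le)+
qed

lemma skew_strip_rows:
  assumes "is_partition lam" "is_partition mu" "strip_rows lam mu p q"
  shows "young lam - young mu = Sigma {p..q} (\<lambda>i. {mu i<..lam i})"
proof (rule Set.set_eqI)
  fix a :: "nat \<times> nat"
  obtain i j where a: "a = (i, j)" by force
  show "a \<in> young lam - young mu \<longleftrightarrow> a \<in> Sigma {p..q} (\<lambda>i. {mu i<..lam i})"
    unfolding a mem_skew[OF assms(1,2)] using strip_rows_gap(2)[OF assms, of i] by auto
qed

text \<open>
  The row lengths telescope, as \<open>lam (Suc i) = Suc (mu i)\<close> inside the strip.
\<close>

lemma card_strip_rows:
  assumes "is_partition lam" "is_partition mu" "strip_rows lam mu p q"
  shows "card (young lam - young mu) + mu q + p = lam p + q"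
proof -
  have "p \<le> q" using assms(3) by (simp add: strip_rows_def)
  have "t \<le> q \<longrightarrow> (\<Sum>i = p..t. lam i - mu i) + mu t + p = lam p + t" if "p \<le> t" for t
    using that
  proof (induction t rule: nat_induct_at_least)
    case base
    then show ?case using strip_rows_gap(1)[OF assms, of p] by simp
  next
    case (Suc t)
    show ?case
    proof
      assume "Suc t \<le> q"
      then have "lam (Suc t) = Suc (mu t)"
        using assms(3) Suc.hyps by (simp add: strip_rows_def)
      moreover from this have "mu (Suc t) \<le> Suc (mu t)"
        using strip_rows_gap(1)[OF assms, of "Suc t"] by simp
      ultimately show "(\<Sum>i = p..Suc t. lam i - mu i) + mu (Suc t) + p = lam p + Suc t"
        using Suc \<open>Suc t \<le> q\<close> by (simp add: sum.nat_ivl_Suc')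
    qed
  qed
  then show ?thesis
    using \<open>p \<le> q\<close> by (simp add: skew_strip_rows[OF assms])
qed

lemma ht_strip_rows:
  assumes "is_partition lam" "is_partition mu" "strip_rows lam mu p q"
  shows "ht (young lam - young mu) = q - p"
proof -
  have "fst ` (young lam - young mu) = {p..q}"
    unfolding skew_strip_rows[OF assms] fst_image_Sigma
    by (auto simp: strip_rows_gap(2)[OF assms])
  then show ?thesis by (simp add: ht_def)
qed

text \<open>
  For connectedness, every box is joined to the last box of the top row \<open>p\<close>: go right to the end of
  the row; as the last box of row \<open>Suc i\<close> lies below the first box of row \<open>i\<close>, step up and repeat.
\<close>

lemma border_strip_if_strip_rows:
  assumes lam: "is_partition lam" and mu: "is_partition mu" and rows: "strip_rows lam mu p q"
  shows "young mu \<subseteq> young lam" and "border_strip (young lam - young mu)"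
proof -
  let ?D = "young lam - young mu"
  let ?E = "{(c, d). c \<in> ?D \<and> d \<in> ?D \<and> share_side c d}"
  have D: "(i, j) \<in> ?D \<longleftrightarrow> mu i < j \<and> j \<le> lam i" for i j by (rule mem_skew[OF lam mu])
  note gap = strip_rows_gap[OF lam mu rows]
  show sub: "young mu \<subseteq> young lam" using gap(1) young_subset_iff[OF lam mu] by blast
  have "(p, lam p) \<in> ?D" using rows unfolding D strip_rows_def by blast
  have sym: "(b, a) \<in> ?E\<^sup>*" if "(a, b) \<in> ?E\<^sup>*" for a b
  proof -
    have "sym ?E" by (auto simp: sym_def share_side_def)
    then show ?thesis using that by (meson sym_rtrancl symD)
  qed
  have row: "((i, j), (i, lam i)) \<in> ?E\<^sup>*" if "mu i < j" "j \<le> lam i" for i j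
    using that(2,1)
  proof (induction j rule: inc_induct)
    case (step j)
    then have "((i, j), (i, Suc j)) \<in> ?E" by (simp add: mem_skew[OF lam mu] share_side_def del: Diff_iff)
    then show ?case using step by (meson converse_rtrancl_into_rtrancl less_SucI)
  qed simp
  have up: "((i, lam i), (p, lam p)) \<in> ?E\<^sup>*" if "p \<le> i" "i \<le> q" for i
    using that
  proof (induction i rule: dec_induct)
    case (step i)
    have eq: "lam (Suc i) = Suc (mu i)" using step rows by (simp add: strip_rows_def)
    have "mu i < lam i" "mu (Suc i) < lam (Suc i)"
      using gap(2) step by auto
    then have "((Suc i, lam (Suc i)), (i, Suc (mu i))) \<in> ?E"
      by (simp add: mem_skew[OF lam mu] share_side_def eq del: Diff_iff)
    moreover have "((i, Suc (mu i)), (i, lam i)) \<in> ?E\<^sup>*"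
      using row \<open>mu i < lam i\<close> by simp
    ultimately show ?case
      using step by (meson converse_rtrancl_into_rtrancl rtrancl_trans Suc_leD)
  qed simp
  have reach: "(a, (p, lam p)) \<in> ?E\<^sup>*" if "a \<in> ?D" for a
  proof -
    obtain i j where a: "a = (i, j)" by force
    then have "mu i < j" "j \<le> lam i" using that D by auto
    moreover from this have "p \<le> i" "i \<le> q" using gap(2)[of i] by auto
    ultimately show ?thesis unfolding a using rtrancl_trans[OF row up] by blast
  qed
  then have "connected_boxes ?D"
    unfolding connected_boxes_def using rtrancl_trans[OF reach sym[OF reach]] by blast
  moreover have "\<not> {(i, j), (i, Suc j), (Suc i, j), (Suc i, Suc j)} \<subseteq> ?D" for i j
  proof
    assume "{(i, j), (i, Suc j), (Suc i, j), (Suc i, Suc j)} \<subseteq> ?D"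
    then have "mu i < j" "Suc j \<le> lam (Suc i)" "mu i < lam i" "mu (Suc i) < lam (Suc i)"
      unfolding insert_subset D by auto
    moreover from this have "p \<le> i" "i < q"
      using gap(2)[of i] gap(2)[of "Suc i"] by auto
    then have "lam (Suc i) = Suc (mu i)"
      using rows by (simp add: strip_rows_def)
    ultimately show False by simp
  qed
  ultimately show "border_strip ?D"
    using lam mu sub \<open>(p, lam p) \<in> ?D\<close> unfolding border_strip_def skew_diagram_def by blast
qed

text \<open>
  The relation \<open>lam (Suc i) = Suc (mu i)\<close> says that the beta number \<open>i\<close> of \<open>mu\<close> becomes the beta number
  \<open>Suc i\<close> of \<open>lam\<close>: inside the strip the sequence moves on by one position, to make room for the
  enlarged beta number at position \<open>p\<close>.
\<close>

lemma agree_off_if_strip_rows: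
  assumes lam: "is_partition lam" "plength lam \<le> n" and mu: "is_partition mu"
    and rows: "strip_rows lam mu p q" and r: "card (young lam - young mu) = r"
  shows "agree_off n (beta_number n mu) q (beta_number n lam) p"
    and "beta_number n lam p = beta_number n mu q + r"
proof -
  \<comment> \<open>Row \<open>q\<close> of \<open>lam\<close> is nonzero, hence among the first \<open>n\<close>.\<close>
  have "lam q \<noteq> 0"
    using strip_rows_gap(2)[OF lam(1) mu rows, of q] rows by (auto simp: strip_rows_def)
  then have "q \<le> n"
    using lam(2) unfolding plength_le_iff[OF lam(1)] by (meson not_le)
  then have pq: "1 \<le> p" "p \<le> q" "q \<le> n"
    using rows by (simp_all add: strip_rows_def)
  show "agree_off n (beta_number n mu) q (beta_number n lam) p"
    unfolding agree_off_def
  proof (intro conjI ballI)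
    fix k assume k: "k \<in> {1..<n}"
    consider "k < p" | "p \<le> k" "k < q" | "q \<le> k" by linarith
    then show "beta_number n mu (skip q k) = beta_number n lam (skip p k)"
      using pq rows k by cases (auto simp: strip_rows_def skip_def beta_number_def)
  qed (use pq in auto)
  show "beta_number n lam p = beta_number n mu q + r"
    using card_strip_rows[OF lam(1) mu rows] r pq by (simp add: beta_number_def)
qed

lemma strip_rows_if_agree_off:
  assumes lam: "is_partition lam" "plength lam \<le> n" and mu: "is_partition mu" "plength mu \<le> n"
    and agree: "agree_off n (beta_number n mu) q (beta_number n lam) p"
    and up: "beta_number n mu q < beta_number n lam p"
  shows "strip_rows lam mu p q"
proof -
  have p: "p \<in> {1..n}" and q: "q \<in> {1..n}"
    and skip: "\<And>k. k \<in> {1..<n} \<Longrightarrow> beta_number n mu (skip q k) = beta_number n lam (skip p k)"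
    using agree by (auto simp: agree_off_def)
  have desc: "beta_number n nu j < beta_number n nu i"
    if "is_partition nu" "i \<in> {1..n}" "j \<in> {1..n}" "i < j" for nu i j
    using monotone_onD[OF strict_antimono_on_beta_number] that by blast
  have "p \<le> q"
  proof (rule ccontr)
    assume "\<not> p \<le> q"
    then have "beta_number n mu (Suc q) = beta_number n lam q" "q \<in> {1..<n}"
      using skip[of q] p q by (auto simp: skip_def)
    moreover have "beta_number n mu (Suc q) < beta_number n mu q" "beta_number n lam p < beta_number n lam q"
      using desc[OF mu(1), of q "Suc q"] desc[OF lam(1), of q p] p q \<open>\<not> p \<le> q\<close> by auto
    ultimately show False using up by simp
  qed
  have outside: "lam i = mu i" if i: "i < p \<or> q < i" for i
  proof -
    consider "i = 0" | "1 \<le> i" "i < p" | "q < i" "i \<le> n" | "n < i" using i by linarith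
    then show ?thesis
    proof cases
      case 2
      then show ?thesis using skip[of i] p q \<open>p \<le> q\<close> by (auto simp: skip_def beta_number_def)
    next
      case 3
      then obtain k where "i = Suc k" "q \<le> k" by (cases i) auto
      then show ?thesis using skip[of k] 3 p q \<open>p \<le> q\<close> by (auto simp: skip_def beta_number_def)
    qed (use lam mu plength_le_iff in \<open>auto simp: is_partition_def\<close>)
  qed
  have inside: "lam (Suc i) = Suc (mu i)" if "p \<le> i" "i < q" for i
    using skip[of i] p q that by (auto simp: skip_def beta_number_def)
  have "mu p < lam p"
  proof (cases "p = q")
    case True
    then show ?thesis using up by (simp add: beta_number_def)
  next
    case False
    then have "p < q" using \<open>p \<le> q\<close> by simp
    then show ?thesis
      using inside[of p] desc[OF lam(1), of p "Suc p"] p q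
      by (auto simp: beta_number_def)
  qed
  then show ?thesis
    using p \<open>p \<le> q\<close> outside inside by (auto simp: strip_rows_def)
qed

text \<open>
  Border strips of \<open>r\<close> boxes correspond to raising one beta number by \<open>r\<close>. With \<open>mu\<close>
  given this describes the strips that can be added, with \<open>lam\<close> given those that can be removed.
\<close>

lemma border_strip_iff_agree_off:
  assumes lam: "is_partition lam" "plength lam \<le> n" and mu: "is_partition mu" "plength mu \<le> n"
    and "r \<ge> 1"
  shows "young mu \<subseteq> young lam \<and> young lam - young mu \<in> BS r \<longleftrightarrow>
    (\<exists>p q. agree_off n (beta_number n mu) q (beta_number n lam) p \<and> beta_number n lam p = beta_number n mu q + r)"
    (is "?strip \<longleftrightarrow> ?moved")
proof
  assume ?strip
  then have strip: "young mu \<subseteq> young lam" "border_strip (young lam - young mu)"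
    and card: "card (young lam - young mu) = r"
    by (simp_all add: BS_def)
  obtain p q where "strip_rows lam mu p q"
    using strip_rows_if_border_strip[OF lam(1) mu(1) strip] .
  from agree_off_if_strip_rows[OF lam mu(1) this card] show ?moved by blast
next
  assume ?moved
  then obtain p q where pq: "agree_off n (beta_number n mu) q (beta_number n lam) p"
    "beta_number n lam p = beta_number n mu q + r" by blast
  then have rows: "strip_rows lam mu p q"
    using strip_rows_if_agree_off[OF lam mu pq(1)] \<open>r \<ge> 1\<close> by simp
  have "card (young lam - young mu) = r"
    using agree_off_if_strip_rows(2)[OF lam mu(1) rows refl] pq(2) by simp
  then show ?strip
    using border_strip_if_strip_rows[OF lam(1) mu(1) rows] by (simp add: BS_def)
qed

lemma ht_sign:
  assumes lam: "is_partition lam" "plength lam \<le> n" and mu: "is_partition mu" "plength mu \<le> n"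
    and "agree_off n (beta_number n mu) q (beta_number n lam) p" "beta_number n mu q < beta_number n lam p"
  shows "(-1 :: 'a::ring_1) ^ ht (young lam - young mu) = (-1) ^ (p + q)"
proof -
  have rows: "strip_rows lam mu p q" by (rule strip_rows_if_agree_off[OF assms])
  then have "p \<le> q" by (simp add: strip_rows_def)
  then show ?thesis
    by (simp add: ht_strip_rows[OF lam(1) mu(1) rows] minus_one_power_iff)
qed

text \<open>
  The sum over \<open>eta\<close> ranges over partitions of any length; without finiteness of its index set it would
  be \<open>0\<close> by convention. The total number of boxes bounds the length and all parts of \<open>eta\<close>.
\<close>

lemma finite_strip_extensions:
  assumes mu: "is_partition mu" and "r \<ge> 1"
  shows "finite {eta. is_partition eta \<and> young mu \<subseteq> young eta \<and> young eta - young mu \<in> BS r}"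
proof (rule finite_subset)
  define M where "M = card (young mu) + r"
  show "finite {f. \<forall>x. (x \<in> {..M} \<longrightarrow> f x \<in> {..M}) \<and> (x \<notin> {..M} \<longrightarrow> f x = (0 :: nat))}"
    by (intro finite_set_of_finite_funs) simp_all
  show "{eta. is_partition eta \<and> young mu \<subseteq> young eta \<and> young eta - young mu \<in> BS r} \<subseteq>
    {f. \<forall>x. (x \<in> {..M} \<longrightarrow> f x \<in> {..M}) \<and> (x \<notin> {..M} \<longrightarrow> f x = 0)}"
  proof clarify
    fix eta assume eta: "is_partition eta" "young mu \<subseteq> young eta" "young eta - young mu \<in> BS r"
    have "young mu = Sigma {i. mu i \<noteq> 0} (\<lambda>i. {1..mu i})"
      using mem_young[OF mu] by auto
    then have fin: "finite (young mu)" using mu by (simp add: is_partition_def)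
    have strip: "card (young eta - young mu) = r" using eta(3) by (simp add: BS_def)
    have "young eta = young mu \<union> (young eta - young mu)" using eta(2) by blast
    moreover have "finite (young eta - young mu)" using strip \<open>r \<ge> 1\<close> by (metis card.infinite not_one_le_zero)
    ultimately have "finite (young eta)" "card (young eta) \<le> M"
      using fin strip card_Un_le[of "young mu" "young eta - young mu"] by (auto simp: M_def)
    then have bound: "card B \<le> M" if "B \<subseteq> young eta" for B
      using card_mono[OF _ that] by simp
    fix i
    \<comment> \<open>Row \<open>i\<close> and the first \<open>i\<close> boxes of the first column have at most as many boxes as the diagram.\<close>
    have "{i} \<times> {1..eta i} \<subseteq> young eta" using mem_young[OF eta(1)] by auto
    from bound[OF this] have "eta i \<le> M" by (simp add: card_cartesian_product)
    moreover have "i \<le> M" if "eta i \<noteq> 0"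
    proof -
      have "1 \<le> eta k" if "k \<in> {1..i}" for k
        using partition_antimono[OF eta(1), of k i] that \<open>eta i \<noteq> 0\<close> by simp
      then have "{1..i} \<times> {1} \<subseteq> young eta" using mem_young[OF eta(1)] by auto
      from bound[OF this] show ?thesis by (simp add: card_cartesian_product)
    qed
    ultimately show "(i \<in> {..M} \<longrightarrow> eta i \<in> {..M}) \<and> (i \<notin> {..M} \<longrightarrow> eta i = 0)" by auto
  qed
qed

section \<open>Summing over replacements of one exponent\<close>

text \<open>
  The common core of the sums over added and over removed strips. Replacing the beta number at \<open>q\<close> by \<open>w q\<close>
  maps the collision-free \<open>q\<close> bijectively onto the partitions in \<open>S\<close>; the remaining \<open>q\<close> contribute
  alternants with two equal columns. The map is injective because the beta number \<open>q\<close> of \<open>mu\<close> is missing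
  from the image of \<open>q\<close> but present in all the others, which is where \<open>w q \<noteq> beta_number n mu q\<close> matters.
\<close>

lemma sum_replace_exponent:
  assumes mu: "is_partition mu" and T: "T \<subseteq> {1..n}"
    and w: "\<And>q. q \<in> T \<Longrightarrow> w q \<noteq> beta_number n mu q"
    and S: "S = {lam. is_partition lam \<and> plength lam \<le> n \<and>
      (\<exists>q\<in>T. \<exists>p. agree_off n (beta_number n mu) q (beta_number n lam) p \<and> beta_number n lam p = w q)}"
    and sign: "\<And>lam q p. lam \<in> S \<Longrightarrow> q \<in> T \<Longrightarrow> agree_off n (beta_number n mu) q (beta_number n lam) p \<Longrightarrow>
      beta_number n lam p = w q \<Longrightarrow> eps lam = (-1) ^ (p + q)"
  shows "(\<Sum>lam\<in>S. eps lam * (alternant n (beta_number n lam) :: 'k::field ratfun)) =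
    (\<Sum>q\<in>T. alternant n ((beta_number n mu)(q := w q)))"
proof -
  let ?l = "beta_number n mu"
  have l: "inj_on ?l {1..n}"
    using strict_antimono_on_beta_number[OF mu] by (simp add: strict_antimono_iff_antimono)
  define T' where "T' = {q\<in>T. w q \<notin> ?l ` ({1..n} - {q})}"
  define F where "F = (\<lambda>q. shape n (descending n (?l(q := w q))))"
  have F: "\<exists>p. is_partition (F q) \<and> plength (F q) \<le> n \<and>
      agree_off n ?l q (beta_number n (F q)) p \<and> beta_number n (F q) p = w q" if "q \<in> T'" for q
  proof -
    have "q \<in> {1..n}" "w q \<notin> ?l ` ({1..n} - {q})" using that T by (auto simp: T'_def)
    from shape_replace[OF mu this] show ?thesis unfolding F_def by metis
  qed
  have "S = F ` T'"
  proof
    show "F ` T' \<subseteq> S" using F unfolding S T'_def by blast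
    show "S \<subseteq> F ` T'"
    proof
      fix lam assume "lam \<in> S"
      then obtain q p where lam: "is_partition lam" "plength lam \<le> n" and q: "q \<in> T"
        and agree: "agree_off n ?l q (beta_number n lam) p" and p: "beta_number n lam p = w q"
        unfolding S by blast
      have desc: "strict_antimono_on {1..n} (beta_number n lam)"
        by (rule strict_antimono_on_beta_number[OF lam(1)])
      then have "inj_on (beta_number n lam) {1..n}" by (simp add: strict_antimono_iff_antimono)
      moreover have "p \<in> {1..n}" using agree by (simp add: agree_off_def)
      ultimately have "w q \<notin> beta_number n lam ` ({1..n} - {p})"
        unfolding p[symmetric] by (auto dest: inj_onD)
      then have "q \<in> T'" using q agree_off_image[OF agree] by (simp add: T'_def)
      have q_nocoll: "q \<in> {1..n}" "w q \<notin> ?l ` ({1..n} - {q})"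
        using \<open>q \<in> T'\<close> T by (auto simp: T'_def)
      have "lam = F q"
      proof (rule shape_replace[OF mu q_nocoll])
        assume *: "is_partition (shape n (descending n (?l(q := w q))))"
          "plength (shape n (descending n (?l(q := w q)))) \<le> n"
          "\<forall>i\<in>{1..n}. beta_number n (shape n (descending n (?l(q := w q)))) i = descending n (?l(q := w q)) i"
        show ?thesis
          unfolding F_def
          by (rule beta_number_inject[OF lam(1) *(1) lam(2) *(2)])
             (simp only: bspec[OF *(3)] agree_off_descending_unique[OF agree desc] p)
      qed
      then show "lam \<in> F ` T'" using \<open>q \<in> T'\<close> by blast
    qed
  qed
  moreover have "inj_on F T'"
  proof (rule inj_onI, rule ccontr)
    fix a b assume ab: "a \<in> T'" "b \<in> T'" "F a = F b" "a \<noteq> b"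
    have range: "beta_number n (F q) ` {1..n} = insert (w q) (?l ` ({1..n} - {q}))" if q: "q \<in> T'" for q
      using F[OF q] agree_off_range by metis
    have a: "a \<in> {1..n}" "w a \<noteq> ?l a" using ab T w by (auto simp: T'_def)
    then have "?l a \<in> insert (w b) (?l ` ({1..n} - {b}))" using ab by blast
    then have "?l a \<in> insert (w a) (?l ` ({1..n} - {a}))"
      using range[OF ab(1)] range[OF ab(2)] ab(3) by simp
    then show False using a inj_onD[OF l] by auto
  qed
  ultimately have "(\<Sum>lam\<in>S. eps lam * (alternant n (beta_number n lam) :: 'k ratfun)) =
      (\<Sum>q\<in>T'. eps (F q) * alternant n (beta_number n (F q)))"
    by (simp add: sum.reindex)
  also have "\<dots> = (\<Sum>q\<in>T'. alternant n (?l(q := w q)))"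
  proof (rule sum.cong[OF refl])
    fix q assume q: "q \<in> T'"
    then obtain p where p: "agree_off n ?l q (beta_number n (F q)) p" "beta_number n (F q) p = w q"
      using F by blast
    have "F q \<in> S" using \<open>S = F ` T'\<close> q by blast
    then have "eps (F q) = (-1) ^ (p + q)" using q p by (intro sign) (auto simp: T'_def)
    then show "eps (F q) * (alternant n (beta_number n (F q)) :: 'k ratfun) = alternant n (?l(q := w q))"
      using alternant_agree_off[OF p(1), where 'k = 'k] p(2) by simp
  qed
  also have "\<dots> = (\<Sum>q\<in>T. alternant n (?l(q := w q)))"
  proof (rule sum.mono_neutral_left)
    show "finite T" using T by (rule finite_subset) simp
    show "T' \<subseteq> T" by (auto simp: T'_def)
    show "\<forall>q\<in>T - T'. (alternant n (?l(q := w q)) :: 'k ratfun) = 0"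
    proof
      fix q assume "q \<in> T - T'"
      then obtain j where "j \<in> {1..n}" "j \<noteq> q" "w q = ?l j" "q \<in> {1..n}"
        using T unfolding T'_def by blast
      then show "(alternant n (?l(q := w q)) :: 'k ratfun) = 0"
        by (intro alternant_collision[of q n j]) auto
    qed
  qed
  finally show ?thesis .
qed

section \<open>The Murnaghan-Nakayama rule\<close>

text \<open>
  As the beta numbers decrease, those at least \<open>r\<close> occupy an initial segment, which ends at \<open>m_e\<close>.
\<close>

lemma above_m_e:
  assumes mu: "is_partition mu"
  shows "{m_e n r mu + 1..n} = {q\<in>{1..n}. beta_number n mu q < r}"
proof (rule Set.set_eqI)
  fix q
  define X where "X = {i\<in>{1..n}. r \<le> beta_number n mu i}"
  have "X = {i\<in>{1..n}. mu i + delta n i \<ge> r}" by (simp add: X_def beta_number_def delta_def)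
  moreover from this have "(\<forall>i\<in>{1..n}. mu i + delta n i < r) \<longleftrightarrow> X = {}"
    by (auto simp: not_le[symmetric] simp del: not_le)
  ultimately have m_e: "m_e n r mu = (if X = {} then 0 else Max X)" by (simp only: m_e_def)
  have fin: "finite X" by (simp add: X_def)
  show "q \<in> {m_e n r mu + 1..n} \<longleftrightarrow> q \<in> {q\<in>{1..n}. beta_number n mu q < r}"
  proof (cases "X = {}")
    case True
    then show ?thesis unfolding m_e by (auto simp: X_def)
  next
    case False
    have "i \<in> X" if i: "i \<in> {1..n}" "i \<le> Max X" for i
    proof (cases "i = Max X")
      case neq: False
      have "Max X \<in> X" using fin False by simp
      then have "r \<le> beta_number n mu (Max X)" "Max X \<in> {1..n}" by (auto simp: X_def)
      moreover have "beta_number n mu (Max X) < beta_number n mu i"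
        using monotone_onD[OF strict_antimono_on_beta_number[OF mu] i(1) \<open>Max X \<in> {1..n}\<close>] i(2) neq by simp
      ultimately show ?thesis using i(1) by (simp add: X_def)
    qed (use fin False in auto)
    moreover have "i \<le> Max X" if "i \<in> X" for i using fin that by simp
    ultimately have "i \<in> {1..n} \<Longrightarrow> i \<in> X \<longleftrightarrow> i \<le> Max X" for i by blast
    from this[of q] False show ?thesis unfolding m_e by (auto simp: X_def)
  qed
qed

text \<open>
  The factor \<open>1 + \<delta>\<close> in each coefficient removes the dependence of the denominator on the partition. If \<open>2 = 0\<close>
  in the field, both sides are \<open>0\<close>.
\<close>

lemma normalized_o_even:
  assumes "plength lam \<le> n"
  shows "s * (1 + of_bool (lam n = 0)) / (1 + of_bool b) * (o_even n lam :: 'k::field ratfun) =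
    2 / ((1 + of_bool b) * alternant n (\<lambda>j. n - j)) * (s * alternant n (beta_number n lam))"
proof -
  let ?A = "alternant n :: (nat \<Rightarrow> nat) \<Rightarrow> 'k ratfun"
  have "(\<lambda>j. lam j + (n - j)) = beta_number n lam" by (simp add: fun_eq_iff beta_number_def)
  then have cancel: "(1 + of_bool (lam n = 0)) * o_even n lam =
      2 * ?A (beta_number n lam) / ?A (\<lambda>j. n - j)"
    using assms by (cases "(2 :: 'k ratfun) = 0") (auto simp: o_even_def)
  have "s * (1 + of_bool (lam n = 0)) / (1 + of_bool b) * o_even n lam =
      s * ((1 + of_bool (lam n = 0)) * o_even n lam) / (1 + of_bool b)"
    by (simp add: mult.assoc)
  then show ?thesis unfolding cancel by (simp add: mult_ac)
qed

text \<open>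
  \<open>Delta\<close>, \<open>mu_e\<close> and \<open>pos\<close> are the sorted sequence, its partition and the new position \<open>p\<close> obtained by
  replacing the beta number at \<open>q\<close>, so the term is an instance of moving one column.
\<close>

lemma reflected_term:
  assumes mu: "is_partition mu" and q: "q \<in> {1..n}"
  shows "(-1) powi (int (pos n r mu q) - int q) * (1 + of_bool (mu_e n r mu q n = 0))
         / (1 + of_bool b) * (o_even_mu_e n r mu q :: 'k::field ratfun) =
    2 / ((1 + of_bool b) * alternant n (\<lambda>j. n - j)) *
      alternant n ((beta_number n mu)(q := r - beta_number n mu q))"
proof -
  let ?v = "r - beta_number n mu q" and ?l = "beta_number n mu"
  have v: "reflected n r mu q = ?v"
    by (simp add: reflected_def beta_number_def delta_def)
  have collision: "collision n r mu q \<longleftrightarrow> ?v \<in> ?l ` ({1..n} - {q})"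
    unfolding collision_def v by (auto simp: beta_number_def delta_def)
  show ?thesis
  proof (cases "collision n r mu q")
    case True
    then obtain j where "j \<in> {1..n}" "j \<noteq> q" "?v = ?l j" using collision by blast
    then have "(alternant n (?l(q := ?v)) :: 'k ratfun) = 0"
      using q by (intro alternant_collision[of q n j]) auto
    then show ?thesis using True by (simp add: o_even_mu_e_def)
  next
    case False
    let ?g = "descending n (?l(q := ?v))"
    have "(\<lambda>j. if j = q then reflected n r mu q else mu j + delta n j) = ?l(q := ?v)"
      by (simp add: fun_eq_iff v) (simp add: beta_number_def delta_def)
    then have Delta: "Delta n r mu q = ?g"
      unfolding Delta_def descending_def by (intro ext) simp
    then have mu_e: "mu_e n r mu q = shape n ?g"
      by (simp add: fun_eq_iff mu_e_def shape_def delta_def)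
    obtain p where shape: "is_partition (shape n ?g)" "plength (shape n ?g) \<le> n"
        "\<forall>i\<in>{1..n}. beta_number n (shape n ?g) i = ?g i"
      and agree: "agree_off n ?l q (beta_number n (shape n ?g)) p" and p: "beta_number n (shape n ?g) p = ?v"
      by (rule shape_replace[OF mu q False[unfolded collision]])
    have "p \<in> {1..n}" using agree by (simp add: agree_off_def)
    have inj: "inj_on (beta_number n (shape n ?g)) {1..n}"
      using strict_antimono_on_beta_number[OF shape(1)] by (simp add: strict_antimono_iff_antimono)
    have "pos n r mu q = p"
      unfolding pos_def v Delta
    proof (rule the_equality)
      show "p \<in> {1..n} \<and> ?g p = ?v" using \<open>p \<in> {1..n}\<close> p shape(3) by simp
      show "i = p" if "i \<in> {1..n} \<and> ?g i = ?v" for i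
        using inj_onD[OF inj _ _ \<open>p \<in> {1..n}\<close>] that p shape(3) by simp
    qed
    then have sign: "(-1) powi (int (pos n r mu q) - int q) = ((-1) ^ (p + q) :: 'k ratfun)"
      by (simp add: power_int_diff minus_one_power_iff)
    have "(o_even_mu_e n r mu q :: 'k ratfun) = o_even n (shape n ?g)"
      using False by (simp add: o_even_mu_e_def mu_e)
    moreover have "(alternant n (?l(q := ?v)) :: 'k ratfun) =
        (-1) ^ (p + q) * alternant n (beta_number n (shape n ?g))"
      using alternant_agree_off[OF agree] by (simp only: p)
    ultimately show ?thesis
      by (simp only: sign mu_e normalized_o_even[OF shape(2)])
  qed
qed

theorem theorem3p10:
  fixes n r :: nat and mu :: "nat \<Rightarrow> nat"
  assumes "n \<ge> 1" and "is_partition mu" and "plength mu \<le> n" and "r \<ge> 1"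
  shows "(p_bar n r :: 'k::field_char_0 ratfun) * o_even n mu =
      (\<Sum>eta | is_partition eta \<and> young mu \<subseteq> young eta \<and> young eta - young mu \<in> BS r.
         (-1) ^ ht (young eta - young mu) * (1 + of_bool (eta n = 0)) / (1 + of_bool (mu n = 0))
         * o_even n eta)
    + (\<Sum>xi | is_partition xi \<and> young xi \<subseteq> young mu \<and> young mu - young xi \<in> BS r.
         (-1) ^ ht (young mu - young xi) * (1 + of_bool (xi n = 0)) / (1 + of_bool (mu n = 0))
         * o_even n xi)
    + (\<Sum>q = m_e n r mu + 1..n.
         (-1) powi (int (pos n r mu q) - int q) * (1 + of_bool (mu_e n r mu q n = 0))
         / (1 + of_bool (mu n = 0)) * o_even_mu_e n r mu q)"
    (is "_ = ?up + ?down + ?reflect")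
proof -
  note mu = assms(2,3)
  let ?l = "beta_number n mu" and ?A = "alternant n :: (nat \<Rightarrow> nat) \<Rightarrow> 'k ratfun"
  define c :: "'k ratfun" where "c = 2 / ((1 + of_bool (mu n = 0)) * alternant n (\<lambda>j. n - j))"
  have normalized: "s * (1 + of_bool (lam n = 0)) / (1 + of_bool (mu n = 0)) * o_even n lam
      = c * (s * ?A (beta_number n lam))" if "plength lam \<le> n" for s lam
    unfolding c_def by (rule normalized_o_even[OF that])
  define U where "U = {eta. is_partition eta \<and> young mu \<subseteq> young eta \<and> young eta - young mu \<in> BS r}"
  \<comment> \<open>Characters of partitions longer than \<open>n\<close> vanish, so only \<open>V\<close> contributes to the first sum.\<close>
  define V where "V = {eta \<in> U. plength eta \<le> n}"
  define W where "W = {xi. is_partition xi \<and> young xi \<subseteq> young mu \<and> young mu - young xi \<in> BS r}"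
  define T where "T = {q\<in>{1..n}. r \<le> ?l q}"

  have "?up = (\<Sum>eta\<in>V. (-1) ^ ht (young eta - young mu) * (1 + of_bool (eta n = 0))
      / (1 + of_bool (mu n = 0)) * o_even n eta)"
    unfolding U_def[symmetric]
  proof (rule sum.mono_neutral_right)
    show "finite U" unfolding U_def by (rule finite_strip_extensions[OF mu(1) assms(4)])
  qed (auto simp: V_def o_even_def)
  also have "\<dots> = c * (\<Sum>eta\<in>V. (-1) ^ ht (young eta - young mu) * ?A (beta_number n eta))"
    unfolding sum_distrib_left by (rule sum.cong[OF refl], rule normalized) (simp add: V_def)
  also have "(\<Sum>eta\<in>V. (-1) ^ ht (young eta - young mu) * ?A (beta_number n eta)) =
      (\<Sum>q = 1..n. ?A (?l(q := ?l q + r)))"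
  proof (rule sum_replace_exponent[OF mu(1) subset_refl])
    show "V = {lam. is_partition lam \<and> plength lam \<le> n \<and>
        (\<exists>q\<in>{1..n}. \<exists>p. agree_off n ?l q (beta_number n lam) p \<and> beta_number n lam p = ?l q + r)}"
      (is "V = ?V")
    proof (rule Set.set_eqI)
      fix lam
      have "young mu \<subseteq> young lam \<and> young lam - young mu \<in> BS r \<longleftrightarrow>
          (\<exists>q\<in>{1..n}. \<exists>p. agree_off n ?l q (beta_number n lam) p \<and> beta_number n lam p = ?l q + r)"
        if "is_partition lam" "plength lam \<le> n"
        unfolding border_strip_iff_agree_off[OF that mu assms(4)] using agree_off_mem by blast
      then show "lam \<in> V \<longleftrightarrow> lam \<in> ?V" by (auto simp: V_def U_def)
    qed
    show "(-1) ^ ht (young lam - young mu) = ((-1) ^ (p + q) :: 'k ratfun)"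
      if "lam \<in> V" "agree_off n ?l q (beta_number n lam) p" "beta_number n lam p = ?l q + r" for lam q p
      using that assms(4) by (intro ht_sign[OF _ _ mu]) (auto simp: V_def U_def)
  qed (use assms(4) in simp)
  finally have up: "?up = c * (\<Sum>q = 1..n. ?A (?l(q := ?l q + r)))" .

  have W_length: "plength xi \<le> n" if "xi \<in> W" for xi
  proof -
    have xi: "is_partition xi" "\<forall>i. xi i \<le> mu i"
      using that young_subset_iff[OF mu(1)] by (auto simp: W_def)
    show ?thesis
      using mu(2) xi(2) unfolding plength_le_iff[OF mu(1)] plength_le_iff[OF xi(1)] by (metis le_zero_eq)
  qed
  have "?down = c * (\<Sum>xi\<in>W. (-1) ^ ht (young mu - young xi) * ?A (beta_number n xi))"
    unfolding W_def[symmetric] sum_distrib_left by (rule sum.cong[OF refl], rule normalized) (rule W_length)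
  also have "(\<Sum>xi\<in>W. (-1) ^ ht (young mu - young xi) * ?A (beta_number n xi)) =
      (\<Sum>q\<in>T. ?A (?l(q := ?l q - r)))"
  proof (rule sum_replace_exponent[OF mu(1)])
    show "W = {lam. is_partition lam \<and> plength lam \<le> n \<and>
        (\<exists>q\<in>T. \<exists>p. agree_off n ?l q (beta_number n lam) p \<and> beta_number n lam p = ?l q - r)}"
      (is "W = ?W")
    proof (rule Set.set_eqI)
      fix xi
      have "young xi \<subseteq> young mu \<and> young mu - young xi \<in> BS r \<longleftrightarrow>
          (\<exists>q\<in>T. \<exists>p. agree_off n ?l q (beta_number n xi) p \<and> beta_number n xi p = ?l q - r)" (is "?L \<longleftrightarrow> ?R")
        if xi: "is_partition xi" "plength xi \<le> n"
      proof -
        \<comment> \<open>Here \<open>mu\<close> is the larger partition, so \<open>p\<close> and \<open>q\<close> exchange their roles.\<close>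
        have "?L \<longleftrightarrow> (\<exists>p q. agree_off n ?l p (beta_number n xi) q \<and> ?l p = beta_number n xi q + r)"
          unfolding border_strip_iff_agree_off[OF mu xi assms(4)] by (simp only: agree_off_sym[of n _ _ ?l])
        also have "\<dots> \<longleftrightarrow> ?R"
        proof
          assume "\<exists>p q. agree_off n ?l p (beta_number n xi) q \<and> ?l p = beta_number n xi q + r"
          then obtain p q where "agree_off n ?l p (beta_number n xi) q" "?l p = beta_number n xi q + r" by blast
          moreover from this have "p \<in> T" "beta_number n xi q = ?l p - r"
            using agree_off_mem(1) by (auto simp: T_def)
          ultimately show ?R by blast
        next
          assume ?R
          then obtain q p where "q \<in> T" "agree_off n ?l q (beta_number n xi) p" "beta_number n xi p = ?l q - r"
            by blast
          moreover from this have "?l q = beta_number n xi p + r" by (simp add: T_def)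
          ultimately show "\<exists>p q. agree_off n ?l p (beta_number n xi) q \<and> ?l p = beta_number n xi q + r"
            by blast
        qed
        finally show ?thesis .
      qed
      then show "xi \<in> W \<longleftrightarrow> xi \<in> ?W" using W_length by (auto simp: W_def)
    qed
    show "(-1) ^ ht (young mu - young xi) = ((-1) ^ (p + q) :: 'k ratfun)"
      if xi: "xi \<in> W" and q: "q \<in> T" and agree: "agree_off n ?l q (beta_number n xi) p"
        and p: "beta_number n xi p = ?l q - r" for xi q p
    proof -
      have "beta_number n xi p < ?l q" using q p assms(4) by (simp add: T_def)
      then have "(-1) ^ ht (young mu - young xi) = ((-1) ^ (q + p) :: 'k ratfun)"
        using xi W_length by (intro ht_sign[OF mu _ _ iffD1[OF agree_off_sym agree]]) (auto simp: W_def)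
      then show ?thesis by (simp add: add.commute)
    qed
  qed (use assms(4) in \<open>auto simp: T_def\<close>)
  finally have down: "?down = c * (\<Sum>q\<in>T. ?A (?l(q := ?l q - r)))" .

  have above: "{m_e n r mu + 1..n} = {1..n} - T"
    unfolding above_m_e[OF mu(1)] by (auto simp: T_def)
  have reflect: "?reflect = c * (\<Sum>q\<in>{1..n} - T. ?A (?l(q := r - ?l q)))"
    unfolding above sum_distrib_left c_def
    by (rule sum.cong[OF refl]) (rule reflected_term[OF mu(1)], blast)

  have "(\<Sum>q = 1..n. ?A (?l(q := if r \<le> ?l q then ?l q - r else r - ?l q))) =
      (\<Sum>q\<in>T. ?A (?l(q := if r \<le> ?l q then ?l q - r else r - ?l q)))
    + (\<Sum>q\<in>{1..n} - T. ?A (?l(q := if r \<le> ?l q then ?l q - r else r - ?l q)))"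
    by (subst sum.subset_diff[of T]) (auto simp: T_def add.commute)
  also have "\<dots> = (\<Sum>q\<in>T. ?A (?l(q := ?l q - r))) + (\<Sum>q\<in>{1..n} - T. ?A (?l(q := r - ?l q)))"
    by (intro arg_cong2[of _ _ _ _ "(+)"] sum.cong) (auto simp: T_def)
  finally have split: "(\<Sum>q = 1..n. ?A (?l(q := if r \<le> ?l q then ?l q - r else r - ?l q))) =
    (\<Sum>q\<in>T. ?A (?l(q := ?l q - r))) + (\<Sum>q\<in>{1..n} - T. ?A (?l(q := r - ?l q)))" .

  have "(o_even n mu :: 'k ratfun) = c * ?A ?l"
    using mu(2) by (simp add: o_even_def c_def beta_number_def[abs_def])
  then have "p_bar n r * o_even n mu = c * (p_bar n r * ?A ?l)" by (simp add: mult.left_commute)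
  also have "\<dots> = ?up + ?down + ?reflect"
    unfolding p_bar_times_alternant split up down reflect by (simp add: distrib_left add.assoc)
  finally show ?thesis .
qed

end
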